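(* Let $\xi=(L^\xi,\Delta_0^\xi,B^\xi,d,G)$ be an EA-stable generic configuration, and let $\alpha=B^\xi+\mathrm{SelfCons}^1(B^\xi,d)$ be $\xi$'s corresponding Level(1) self-justifying axiom system. Then there exists a translation methodology $T$ (mapping each $\Pi_1^\xi$ sentence $\Psi$ to a $\Pi_1^\xi$ sentence $\Psi^T$ equivalent to $\Psi$ in the Standard-M model) such that $\alpha$ can prove $$\forall p\ [\ \mathrm{Prf}_{\alpha,d}(\lceil\Psi\rceil,p)\Rightarrow\Psi^T\ ]$$ for all $\Pi_1^\xi$ sentences $\Psi$ simultaneously.
   Context: **Generic configurations.** Standard-M is the standard model of the natural numbers. $\mathrm{Log}$ is the base-2 logarithm. A generic configuration $\xi$ is a 5-tuple $(L^\xi,\Delta_0^\xi,B^\xi,d,G)$ where: (1) $L^\xi$ is a language with symbols for $0,1,2,=,\le$ and $\mathrm{Maximum}(x,y)$, and enough function and constant symbols that every integer $k$ is the value of some term $T_k$. (2) $\Delta_0^\xi$ is a fixed class of fully bounded $L^\xi$-formulas (all quantifiers have the form $\exists v\le T$ or $\forall v\le T$ with $T$ a term), closed under negation, and rich enough to contain two formulas $\mathrm{Add}(x,y,z)$ and $\mathrm{Mult}(x,y,z)$ defining the graphs of addition and multiplication. Every $\Delta_0^\xi$ formula is both $\Pi_0^\xi$ and $\Sigma_0^\xi$; for $n\ge1$ a formula is $\Pi_n^\xi$ (resp. $\Sigma_n^\xi$) iff it can be written $\forall v_1\cdots\forall v_k\,\Phi$ with $\Phi\in\Sigma_{n-1}^\xi$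 (resp. $\exists v_1\cdots\exists v_k\,\Phi$ with $\Phi\in\Pi_{n-1}^\xi$); $\Delta_0^\xi$ sentences count as both $\Pi_1^\xi$ and $\Sigma_1^\xi$. (3) $B^\xi$ (the base axiom system) is an axiom system whose axioms are true in Standard-M and which is $\Sigma_1^\xi$-complete: it proves every true $\Sigma_1^\xi$ sentence and refutes every false $\Pi_1^\xi$ sentence. (4) $d$ is a deduction method, conventional enough to satisfy the indirect-implication property associated with Gödel's Completeness Theorem: whether or not modus ponens is built in, whenever it can prove $X$, $Y$ and $(X\wedge Y)\to Z$, it can prove $Z$ (possibly by a much longer proof). (5) $G$ is a method for encoding the Gödel numbers of proofs. Proofs are identified with their Gödel numbers $p$. **Goodness.** $E(N)$ is a term of value $2^N$. For a prenex sentence $\Upsilon$, $\mathrm{Scope}_E(\Upsilon,N)$ is obtained from $\Upsilon$ by replacing each unbounded $\forall v$ by $\forall v<E(N)$ and each unbounded $\exists v$ by $\exists v<E(N)$, leaving the bounded quantifiers of the $\Delta_0^\xi$ part unchanged. A $\Pi_1^\xi$ or $\Sigma_1^\xi$ sentence $\Upsilon$ is $\mathrm{Good}(N)$ when $\mathrm{Scope}_E(\Upsilon,N)$ is true in Standard-M ($\mathrm{Good}(\infty)$ means true in Standard-M). For a set $\theta$ of $\Pi_1^\xi$ sentences, $\sharp(\theta)$ is the largest integer $J$ such that every sentence of $\theta$ is $\mathrm{Good}(J)$, and $\sharp(\theta)=\infty$ if this holds for all $J$. **Stability.** $\mathrm{RE\text{-}Class}(\xi)$ is the set of all recursively enumerable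 sets $\theta$ of $\Pi_1^\xi$ sentences (true or not). - $\xi$ is A-stable iff for every $\theta\in\mathrm{RE\text{-}Class}(\xi)$: if $\Upsilon$ is a $\Pi_1^\xi$ theorem of $\theta\cup B^\xi$ via a proof $p$ with $\mathrm{Log}(p)\le\sharp(\theta)+1$, then $\Upsilon$ is $\mathrm{Good}\{\tfrac12\sharp(\theta)\}$. - $\xi$ is E-stable iff for every $\theta\in\mathrm{RE\text{-}Class}(\xi)$: if $\Upsilon$ is a $\Sigma_1^\xi$ theorem of $\theta\cup B^\xi$ via a proof $p$ with $\mathrm{Log}(p)\le\sharp(\theta)+1$, then $\Upsilon$ is $\mathrm{Good}\{\tfrac12\lfloor\mathrm{Log}(p)\rfloor-1\}$. - $\xi$ is EA-stable iff it is both E-stable and A-stable. **Self-consistency axioms.** An axiom system $\alpha\supseteq B^\xi$ is Level$(k^\xi)$ consistent when there are no proofs from $\alpha$ via $d$ of both a $\Pi_k^\xi$ sentence and the $\Sigma_k^\xi$ sentence that is its negation. For $\beta\supseteq B^\xi$, $\mathrm{SelfCons}^k(\beta,d)$ is a self-referencing $\Pi_1^\xi$ sentence asserting the Level$(k^\xi)$ consistency of $\beta+\mathrm{SelfCons}^k(\beta,d)$. Explicitly, use $\Delta_0^\xi$ formulas: $\mathrm{Neg}^k(x,y)$: $x$ is the Gödel number of a $\Pi_k^\xi$ sentence and $y$ that of the $\Sigma_k^\xi$ sentence which is its negation; $\mathrm{SubstPrf}^d_\beta(g,t,p)$: there is $h$ such that $h$ encodes the sentence obtained from the formula with code $g$ by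 replacing its free variables by the numeral $\bar g$, and $p$ is a proof of $t$ via $d$ from $\beta$ together with the sentence coded by $h$. Let $\Gamma^k(g)$ be $\forall x\forall y\forall p\forall q\ \neg\{\mathrm{Neg}^k(x,y)\wedge\mathrm{SubstPrf}^d_\beta(g,x,p)\wedge\mathrm{SubstPrf}^d_\beta(g,y,q)\}$ and $n$ its Gödel number; then $\mathrm{SelfCons}^k(\beta,d)$ is $\Gamma^k(\bar n)$. **Translations.** A translation methodology $T$ is an algorithm that maps each $\Pi_1^\xi$ sentence $\Psi$ onto a sentence $\Psi^T$ that is equivalent to $\Psi$ in Standard-M and which is also written in $\Pi_1^\xi$ format. $\lceil\Psi\rceil$ is the Gödel number of $\Psi$, and $\mathrm{Prf}_{\alpha,d}(t,p)$ is the formula stating that $p$ is a proof of $t$ from $\alpha$ using $d$. *)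

theory Defs
  imports Complex_Main "HOL-Library.Extended_Real"
begin

section \<open>Syntax\<close>

text \<open>
  Formulas are in de Bruijn form: \<open>Var 0\<close> refers to the innermost quantifier. Bounded quantifiers
  are primitive, so that the unbounded prefix of a formula is determined by the formula. The bound
  \<open>t\<close> in \<open>BForall t \<phi>\<close> and \<open>BExists t \<phi>\<close> lies outside the scope of the quantifier.
\<close>

datatype 'f trm = Var nat | Fn 'f "'f trm list"

datatype ('f, 'r) fm =
    Eq "'f trm" "'f trm"
  | Leq "'f trm" "'f trm"
  | Rel 'r "'f trm list"
  | Neg "('f, 'r) fm"
  | Conj "('f, 'r) fm" "('f, 'r) fm"
  | Disj "('f, 'r) fm" "('f, 'r) fm"
  | Imp "('f, 'r) fm" "('f, 'r) fm"
  | Forall "('f, 'r) fm"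
  | Exists "('f, 'r) fm"
  | BForall "'f trm" "('f, 'r) fm"
  | BExists "'f trm" "('f, 'r) fm"

abbreviation Less :: "'f trm \<Rightarrow> 'f trm \<Rightarrow> ('f, 'r) fm" where
  "Less s t \<equiv> Conj (Leq s t) (Neg (Eq s t))"

primrec subst_trm :: "(nat \<Rightarrow> 'f trm) \<Rightarrow> 'f trm \<Rightarrow> 'f trm" where
  "subst_trm s (Var i) = s i"
| "subst_trm s (Fn f ts) = Fn f (map (subst_trm s) ts)"

definition lift_subst :: "(nat \<Rightarrow> 'f trm) \<Rightarrow> nat \<Rightarrow> 'f trm" where
  "lift_subst s = case_nat (Var 0) (\<lambda>i. subst_trm (\<lambda>j. Var (Suc j)) (s i))"

primrec subst :: "(nat \<Rightarrow> 'f trm) \<Rightarrow> ('f, 'r) fm \<Rightarrow> ('f, 'r) fm" where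
  "subst s (Eq t u) = Eq (subst_trm s t) (subst_trm s u)"
| "subst s (Leq t u) = Leq (subst_trm s t) (subst_trm s u)"
| "subst s (Rel r ts) = Rel r (map (subst_trm s) ts)"
| "subst s (Neg \<phi>) = Neg (subst s \<phi>)"
| "subst s (Conj \<phi> \<psi>) = Conj (subst s \<phi>) (subst s \<psi>)"
| "subst s (Disj \<phi> \<psi>) = Disj (subst s \<phi>) (subst s \<psi>)"
| "subst s (Imp \<phi> \<psi>) = Imp (subst s \<phi>) (subst s \<psi>)"
| "subst s (Forall \<phi>) = Forall (subst (lift_subst s) \<phi>)"
| "subst s (Exists \<phi>) = Exists (subst (lift_subst s) \<phi>)"
| "subst s (BForall t \<phi>) = BForall (subst_trm s t) (subst (lift_subst s) \<phi>)"
| "subst s (BExists t \<phi>) = BExists (subst_trm s t) (subst (lift_subst s) \<phi>)"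

text \<open>\<open>inst \<phi> [t\<^sub>0, \<dots>, t\<^sub>m]\<close> is \<open>\<phi>(t\<^sub>0, \<dots>, t\<^sub>m)\<close> for a formula \<open>\<phi>\<close> with free variables
  \<open>Var 0, \<dots>, Var m\<close>.\<close>

definition inst :: "('f, 'r) fm \<Rightarrow> 'f trm list \<Rightarrow> ('f, 'r) fm" where
  "inst \<phi> ts = subst (\<lambda>i. if i < length ts then ts ! i else Var i) \<phi>"

primrec fully_bounded :: "('f, 'r) fm \<Rightarrow> bool" where
  "fully_bounded (Eq t u) = True"
| "fully_bounded (Leq t u) = True"
| "fully_bounded (Rel r ts) = True"
| "fully_bounded (Neg \<phi>) = fully_bounded \<phi>"
| "fully_bounded (Conj \<phi> \<psi>) = (fully_bounded \<phi> \<and> fully_bounded \<psi>)"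
| "fully_bounded (Disj \<phi> \<psi>) = (fully_bounded \<phi> \<and> fully_bounded \<psi>)"
| "fully_bounded (Imp \<phi> \<psi>) = (fully_bounded \<phi> \<and> fully_bounded \<psi>)"
| "fully_bounded (Forall \<phi>) = False"
| "fully_bounded (Exists \<phi>) = False"
| "fully_bounded (BForall t \<phi>) = fully_bounded \<phi>"
| "fully_bounded (BExists t \<phi>) = fully_bounded \<phi>"

text \<open>The negation of a prenex formula in prenex form: \<open>\<forall>v \<dots> \<Phi>\<close> becomes \<open>\<exists>v \<dots> \<not> \<Phi>\<close>, so the negation
  of a \<open>\<Pi>\<^sub>k\<close> sentence is a \<open>\<Sigma>\<^sub>k\<close> sentence.\<close>

fun prenex_neg :: "('f, 'r) fm \<Rightarrow> ('f, 'r) fm" where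
  "prenex_neg (Forall \<phi>) = Exists (prenex_neg \<phi>)"
| "prenex_neg (Exists \<phi>) = Forall (prenex_neg \<phi>)"
| "prenex_neg \<phi> = Neg \<phi>"

text \<open>\<open>scope E \<Upsilon>\<close> bounds the unbounded prefix of a prenex \<open>\<Upsilon>\<close> by the closed term \<open>E\<close>.\<close>

fun scope :: "'f trm \<Rightarrow> ('f, 'r) fm \<Rightarrow> ('f, 'r) fm" where
  "scope E (Forall \<phi>) = Forall (Imp (Less (Var 0) E) (scope E \<phi>))"
| "scope E (Exists \<phi>) = Exists (Conj (Less (Var 0) E) (scope E \<phi>))"
| "scope E \<phi> = \<phi>"


section \<open>Structures and logical validity\<close>

record ('u, 'f, 'r) struct =
  dom :: "'u set"
  fn :: "'f \<Rightarrow> 'u list \<Rightarrow> 'u"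
  rel :: "'r \<Rightarrow> 'u list \<Rightarrow> bool"
  le :: "'u \<Rightarrow> 'u \<Rightarrow> bool"

primrec val :: "('u, 'f, 'r) struct \<Rightarrow> (nat \<Rightarrow> 'u) \<Rightarrow> 'f trm \<Rightarrow> 'u" where
  "val M e (Var i) = e i"
| "val M e (Fn f ts) = fn M f (map (val M e) ts)"

primrec sat :: "('u, 'f, 'r) struct \<Rightarrow> (nat \<Rightarrow> 'u) \<Rightarrow> ('f, 'r) fm \<Rightarrow> bool" where
  "sat M e (Eq t u) = (val M e t = val M e u)"
| "sat M e (Leq t u) = le M (val M e t) (val M e u)"
| "sat M e (Rel r ts) = rel M r (map (val M e) ts)"
| "sat M e (Neg \<phi>) = (\<not> sat M e \<phi>)"
| "sat M e (Conj \<phi> \<psi>) = (sat M e \<phi> \<and> sat M e \<psi>)"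
| "sat M e (Disj \<phi> \<psi>) = (sat M e \<phi> \<or> sat M e \<psi>)"
| "sat M e (Imp \<phi> \<psi>) = (sat M e \<phi> \<longrightarrow> sat M e \<psi>)"
| "sat M e (Forall \<phi>) = (\<forall>a\<in>dom M. sat M (case_nat a e) \<phi>)"
| "sat M e (Exists \<phi>) = (\<exists>a\<in>dom M. sat M (case_nat a e) \<phi>)"
| "sat M e (BForall t \<phi>) = (\<forall>a\<in>dom M. le M a (val M e t) \<longrightarrow> sat M (case_nat a e) \<phi>)"
| "sat M e (BExists t \<phi>) = (\<exists>a\<in>dom M. le M a (val M e t) \<and> sat M (case_nat a e) \<phi>)"

text \<open>A language comes with its interpretation in the standard model. \<open>numeral_of L k\<close> is the term
  \<open>T\<^sub>k\<close>.\<close>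

record ('f, 'r) language =
  fn_arity :: "'f \<Rightarrow> nat"
  rel_arity :: "'r \<Rightarrow> nat"
  std_fn :: "'f \<Rightarrow> nat list \<Rightarrow> nat"
  std_rel :: "'r \<Rightarrow> nat list \<Rightarrow> bool"
  zero_sym :: 'f
  one_sym :: 'f
  two_sym :: 'f
  max_sym :: 'f
  numeral_of :: "nat \<Rightarrow> 'f trm"

definition standard_model :: "('f, 'r) language \<Rightarrow> (nat, 'f, 'r) struct" where
  "standard_model L = \<lparr>dom = UNIV, fn = std_fn L, rel = std_rel L, le = (\<le>)\<rparr>"

text \<open>\<open>wf_trm L n t\<close> and \<open>wf_fm L n \<phi>\<close>: arities are respected and all free variables are below \<open>n\<close>.\<close>

primrec wf_trm :: "('f, 'r) language \<Rightarrow> nat \<Rightarrow> 'f trm \<Rightarrow> bool" where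
  "wf_trm L n (Var i) = (i < n)"
| "wf_trm L n (Fn f ts) = (length ts = fn_arity L f \<and> list_all (wf_trm L n) ts)"

primrec wf_fm :: "('f, 'r) language \<Rightarrow> nat \<Rightarrow> ('f, 'r) fm \<Rightarrow> bool" where
  "wf_fm L n (Eq t u) = (wf_trm L n t \<and> wf_trm L n u)"
| "wf_fm L n (Leq t u) = (wf_trm L n t \<and> wf_trm L n u)"
| "wf_fm L n (Rel r ts) = (length ts = rel_arity L r \<and> list_all (wf_trm L n) ts)"
| "wf_fm L n (Neg \<phi>) = wf_fm L n \<phi>"
| "wf_fm L n (Conj \<phi> \<psi>) = (wf_fm L n \<phi> \<and> wf_fm L n \<psi>)"
| "wf_fm L n (Disj \<phi> \<psi>) = (wf_fm L n \<phi> \<and> wf_fm L n \<psi>)"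
| "wf_fm L n (Imp \<phi> \<psi>) = (wf_fm L n \<phi> \<and> wf_fm L n \<psi>)"
| "wf_fm L n (Forall \<phi>) = wf_fm L (Suc n) \<phi>"
| "wf_fm L n (Exists \<phi>) = wf_fm L (Suc n) \<phi>"
| "wf_fm L n (BForall t \<phi>) = (wf_trm L n t \<and> wf_fm L (Suc n) \<phi>)"
| "wf_fm L n (BExists t \<phi>) = (wf_trm L n t \<and> wf_fm L (Suc n) \<phi>)"

definition formulas :: "('f, 'r) language \<Rightarrow> ('f, 'r) fm set" where
  "formulas L = {\<phi>. \<exists>n. wf_fm L n \<phi>}"

definition sentences :: "('f, 'r) language \<Rightarrow> ('f, 'r) fm set" where
  "sentences L = {\<phi>. wf_fm L 0 \<phi>}"

definition structure_for :: "('f, 'r) language \<Rightarrow> ('u, 'f, 'r) struct \<Rightarrow> bool" where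
  "structure_for L M \<longleftrightarrow> dom M \<noteq> {} \<and>
     (\<forall>f xs. length xs = fn_arity L f \<longrightarrow> set xs \<subseteq> dom M \<longrightarrow> fn M f xs \<in> dom M)"

text \<open>Entailment between sentences. Since the languages below are countable, it suffices by the
  downward Loewenheim-Skolem theorem to consider structures whose domain is a nonempty (possibly
  finite) set of natural numbers. Equality is interpreted as identity, whereas \<open>\<le>\<close> and all other
  symbols are non-logical.\<close>

definition entails :: "('f, 'r) language \<Rightarrow> ('f, 'r) fm set \<Rightarrow> ('f, 'r) fm \<Rightarrow> bool" where
  "entails L A X \<longleftrightarrow>
     (\<forall>(M :: (nat, 'f, 'r) struct) e. structure_for L M \<longrightarrow> range e \<subseteq> dom M \<longrightarrow>
        (\<forall>\<phi>\<in>A. sat M e \<phi>) \<longrightarrow> sat M e X)"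

definition true_std :: "('f, 'r) language \<Rightarrow> ('f, 'r) fm \<Rightarrow> bool" where
  "true_std L \<phi> \<longleftrightarrow> (\<forall>e. sat (standard_model L) e \<phi>)"

text \<open>\<open>holds_std L \<phi> [a\<^sub>0, \<dots>, a\<^sub>m]\<close>: the standard model satisfies \<open>\<phi>(a\<^sub>0, \<dots>, a\<^sub>m)\<close>.\<close>

definition holds_std :: "('f, 'r) language \<Rightarrow> ('f, 'r) fm \<Rightarrow> nat list \<Rightarrow> bool" where
  "holds_std L \<phi> as \<longleftrightarrow> sat (standard_model L) (\<lambda>i. if i < length as then as ! i else 0) \<phi>"


section \<open>Recursive functions\<close>

text \<open>\<open>recursive n f\<close>: \<open>f\<close>, restricted to lists of length \<open>n\<close>, is a total \<open>n\<close>-ary recursive function;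
  minimisation is only applied to functions for which a zero always exists.\<close>

inductive recursive :: "nat \<Rightarrow> (nat list \<Rightarrow> nat) \<Rightarrow> bool" where
  rec_zero: "recursive n (\<lambda>xs. 0)"
| rec_suc: "recursive 1 (\<lambda>xs. Suc (xs ! 0))"
| rec_proj: "i < n \<Longrightarrow> recursive n (\<lambda>xs. xs ! i)"
| rec_comp: "recursive (length gs) f \<Longrightarrow> \<forall>g\<in>set gs. recursive n g \<Longrightarrow>
    recursive n (\<lambda>xs. f (map (\<lambda>g. g xs) gs))"
| rec_prim: "recursive n f \<Longrightarrow> recursive (Suc (Suc n)) g \<Longrightarrow>
    recursive (Suc n) (\<lambda>xs. rec_nat (f (tl xs)) (\<lambda>k r. g (k # r # tl xs)) (hd xs))"
| rec_mu: "recursive (Suc n) f \<Longrightarrow> \<forall>xs. length xs = n \<longrightarrow> (\<exists>y. f (y # xs) = 0) \<Longrightarrow>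
    recursive n (\<lambda>xs. LEAST y. f (y # xs) = 0)"

definition rec_enumerable :: "nat set \<Rightarrow> bool" where
  "rec_enumerable S \<longleftrightarrow> S = {} \<or> (\<exists>f. recursive 1 f \<and> S = range (\<lambda>x. f [x]))"


section \<open>Generic configurations\<close>

text \<open>\<open>ded \<xi> A X \<pi>\<close>: the object \<open>\<pi>\<close> is a proof of \<open>X\<close> from the axioms \<open>A\<close>. The encoding \<open>G\<close> numbers
  formulas and proofs.\<close>

record ('f, 'r, 'p) encoding =
  code_fm :: "('f, 'r) fm \<Rightarrow> nat"
  code_prf :: "'p \<Rightarrow> nat"

record ('f, 'r, 'p) configuration =
  lang :: "('f, 'r) language"
  Delta0 :: "('f, 'r) fm set"
  base :: "('f, 'r) fm set"
  ded :: "('f, 'r) fm set \<Rightarrow> ('f, 'r) fm \<Rightarrow> 'p \<Rightarrow> bool"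
  enc :: "('f, 'r, 'p) encoding"

abbreviation numl :: "('f, 'r, 'p) configuration \<Rightarrow> nat \<Rightarrow> 'f trm" where
  "numl \<xi> \<equiv> numeral_of (lang \<xi>)"

abbreviation gn :: "('f, 'r, 'p) configuration \<Rightarrow> ('f, 'r) fm \<Rightarrow> nat" where
  "gn \<xi> \<equiv> code_fm (enc \<xi>)"

definition proof_of ::
    "('f, 'r, 'p) configuration \<Rightarrow> ('f, 'r) fm set \<Rightarrow> ('f, 'r) fm \<Rightarrow> nat \<Rightarrow> bool" where
  "proof_of \<xi> A X p \<longleftrightarrow> (\<exists>\<pi>. code_prf (enc \<xi>) \<pi> = p \<and> ded \<xi> A X \<pi>)"

definition proves :: "('f, 'r, 'p) configuration \<Rightarrow> ('f, 'r) fm set \<Rightarrow> ('f, 'r) fm \<Rightarrow> bool" where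
  "proves \<xi> A X \<longleftrightarrow> (\<exists>p. proof_of \<xi> A X p)"

fun Pi_class :: "('f, 'r, 'p) configuration \<Rightarrow> nat \<Rightarrow> ('f, 'r) fm set"
  and Sigma_class :: "('f, 'r, 'p) configuration \<Rightarrow> nat \<Rightarrow> ('f, 'r) fm set" where
  "Pi_class \<xi> 0 = Delta0 \<xi>"
| "Pi_class \<xi> (Suc n) = {(Forall ^^ k) \<Phi> | k \<Phi>. \<Phi> \<in> Sigma_class \<xi> n}"
| "Sigma_class \<xi> 0 = Delta0 \<xi>"
| "Sigma_class \<xi> (Suc n) = {(Exists ^^ k) \<Phi> | k \<Phi>. \<Phi> \<in> Pi_class \<xi> n}"

definition Pi_sent :: "('f, 'r, 'p) configuration \<Rightarrow> nat \<Rightarrow> ('f, 'r) fm set" where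
  "Pi_sent \<xi> k = Pi_class \<xi> k \<inter> sentences (lang \<xi>)"

definition Sigma_sent :: "('f, 'r, 'p) configuration \<Rightarrow> nat \<Rightarrow> ('f, 'r) fm set" where
  "Sigma_sent \<xi> k = Sigma_class \<xi> k \<inter> sentences (lang \<xi>)"

definition generic_language :: "('f, 'r) language \<Rightarrow> bool" where
  "generic_language L \<longleftrightarrow>
     fn_arity L (zero_sym L) = 0 \<and> std_fn L (zero_sym L) [] = 0 \<and>
     fn_arity L (one_sym L) = 0 \<and> std_fn L (one_sym L) [] = 1 \<and>
     fn_arity L (two_sym L) = 0 \<and> std_fn L (two_sym L) [] = 2 \<and>
     fn_arity L (max_sym L) = 2 \<and> (\<forall>x y. std_fn L (max_sym L) [x, y] = max x y) \<and>
     (\<forall>k. wf_trm L 0 (numeral_of L k) \<and> (\<forall>e. val (standard_model L) e (numeral_of L k) = k))"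

text \<open>Closure under conjunction and under substitution of terms is what makes the matrix of the
  sentence \<open>selfcons\<close> below, and hence that sentence, formally \<open>\<Pi>\<^sub>1\<close>.\<close>

definition generic_Delta0 :: "('f, 'r) language \<Rightarrow> ('f, 'r) fm set \<Rightarrow> bool" where
  "generic_Delta0 L D \<longleftrightarrow>
     (\<forall>\<phi>\<in>D. \<phi> \<in> formulas L \<and> fully_bounded \<phi>) \<and>
     (\<forall>\<phi>\<in>D. Neg \<phi> \<in> D) \<and>
     (\<forall>\<phi>\<in>D. \<forall>\<psi>\<in>D. Conj \<phi> \<psi> \<in> D) \<and>
     (\<forall>\<phi>\<in>D. \<forall>s. (\<forall>i. \<exists>n. wf_trm L n (s i)) \<longrightarrow> subst s \<phi> \<in> D) \<and>
     (\<exists>add\<in>D. wf_fm L 3 add \<and> (\<forall>x y z. holds_std L add [x, y, z] \<longleftrightarrow> x + y = z)) \<and>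
     (\<exists>mult\<in>D. wf_fm L 3 mult \<and> (\<forall>x y z. holds_std L mult [x, y, z] \<longleftrightarrow> x * y = z))"

definition generic_base :: "('f, 'r, 'p) configuration \<Rightarrow> bool" where
  "generic_base \<xi> \<longleftrightarrow>
     (\<forall>\<phi>\<in>base \<xi>. \<phi> \<in> sentences (lang \<xi>) \<and> true_std (lang \<xi>) \<phi>) \<and>
     (\<forall>\<phi>\<in>Sigma_sent \<xi> 1. true_std (lang \<xi>) \<phi> \<longrightarrow> proves \<xi> (base \<xi>) \<phi>) \<and>
     (\<forall>\<phi>\<in>Pi_sent \<xi> 1. \<not> true_std (lang \<xi>) \<phi> \<longrightarrow> proves \<xi> (base \<xi>) (Neg \<phi>))"

text \<open>What is used of a conventional deduction method, besides the indirect-implication property: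
  soundness, provability of axioms, monotonicity in the axioms, and Goedel's completeness theorem for
  logically valid sentences.\<close>

definition conventional_ded :: "('f, 'r, 'p) configuration \<Rightarrow> bool" where
  "conventional_ded \<xi> \<longleftrightarrow>
     (\<forall>A X. A \<subseteq> sentences (lang \<xi>) \<longrightarrow> X \<in> sentences (lang \<xi>) \<longrightarrow>
        proves \<xi> A X \<longrightarrow> entails (lang \<xi>) A X) \<and>
     (\<forall>A X. A \<subseteq> sentences (lang \<xi>) \<longrightarrow> X \<in> A \<longrightarrow> proves \<xi> A X) \<and>
     (\<forall>A A' X. A \<subseteq> A' \<longrightarrow> A' \<subseteq> sentences (lang \<xi>) \<longrightarrow> X \<in> sentences (lang \<xi>) \<longrightarrow>
        proves \<xi> A X \<longrightarrow> proves \<xi> A' X) \<and>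
     (\<forall>A X. A \<subseteq> sentences (lang \<xi>) \<longrightarrow> X \<in> sentences (lang \<xi>) \<longrightarrow>
        entails (lang \<xi>) {} X \<longrightarrow> proves \<xi> A X) \<and>
     (\<forall>A X Y Z. A \<subseteq> sentences (lang \<xi>) \<longrightarrow> {X, Y, Z} \<subseteq> sentences (lang \<xi>) \<longrightarrow>
        proves \<xi> A X \<longrightarrow> proves \<xi> A Y \<longrightarrow> proves \<xi> A (Imp (Conj X Y) Z) \<longrightarrow> proves \<xi> A Z)"

text \<open>Goedel numberings are injective and effective: replacing the free variables of a formula by a
  numeral is a recursive operation on codes.\<close>

definition goedel_encoding :: "('f, 'r) language \<Rightarrow> ('f, 'r, 'p) encoding \<Rightarrow> bool" where
  "goedel_encoding L G \<longleftrightarrow>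
     inj_on (code_fm G) (formulas L) \<and> inj (code_prf G) \<and>
     (\<exists>f. recursive 2 f \<and>
        (\<forall>\<phi>\<in>formulas L. \<forall>k. f [code_fm G \<phi>, k] = code_fm G (subst (\<lambda>_. numeral_of L k) \<phi>)))"

definition generic_configuration :: "('f, 'r, 'p) configuration \<Rightarrow> bool" where
  "generic_configuration \<xi> \<longleftrightarrow>
     generic_language (lang \<xi>) \<and> generic_Delta0 (lang \<xi>) (Delta0 \<xi>) \<and> generic_base \<xi> \<and>
     conventional_ded \<xi> \<and> goedel_encoding (lang \<xi>) (enc \<xi>)"


section \<open>Goodness and stability\<close>

text \<open>\<open>Good(N)\<close> is also applied to half-integers and to negative \<open>N\<close>. For a natural number \<open>v\<close>, the
  condition \<open>v < 2\<^sup>N\<close> is the same as \<open>v < \<lceil>2\<^sup>N\<rceil>\<close>, so \<open>E(N)\<close> is the numeral of \<open>\<lceil>2\<^sup>N\<rceil>\<close>. The value at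
  \<open>-\<infinity>\<close> is irrelevant.\<close>

definition E_term :: "('f, 'r, 'p) configuration \<Rightarrow> real \<Rightarrow> 'f trm" where
  "E_term \<xi> N = numl \<xi> (nat \<lceil>2 powr N\<rceil>)"

definition good :: "('f, 'r, 'p) configuration \<Rightarrow> ('f, 'r) fm \<Rightarrow> ereal \<Rightarrow> bool" where
  "good \<xi> \<Upsilon> N \<longleftrightarrow>
     (if N = \<infinity> then true_std (lang \<xi>) \<Upsilon>
      else true_std (lang \<xi>) (scope (E_term \<xi> (real_of_ereal N)) \<Upsilon>))"

text \<open>If no integer \<open>J\<close> qualifies, as when \<open>\<theta>\<close> contains a sentence falsified at \<open>0\<close>, this is \<open>-\<infinity>\<close>.\<close>

definition sharp :: "('f, 'r, 'p) configuration \<Rightarrow> ('f, 'r) fm set \<Rightarrow> ereal" where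
  "sharp \<xi> \<theta> = Sup {ereal (real_of_int J) | J. \<forall>\<Psi>\<in>\<theta>. good \<xi> \<Psi> (ereal (real_of_int J))}"

definition RE_Class :: "('f, 'r, 'p) configuration \<Rightarrow> ('f, 'r) fm set set" where
  "RE_Class \<xi> = {\<theta>. \<theta> \<subseteq> Pi_sent \<xi> 1 \<and> rec_enumerable (gn \<xi> ` \<theta>)}"

text \<open>Here \<open>Log 0\<close> takes the library value \<open>0\<close>.\<close>

definition A_stable :: "('f, 'r, 'p) configuration \<Rightarrow> bool" where
  "A_stable \<xi> \<longleftrightarrow>
     (\<forall>\<theta>\<in>RE_Class \<xi>. \<forall>\<Upsilon>\<in>Pi_sent \<xi> 1. \<forall>p.
        proof_of \<xi> (\<theta> \<union> base \<xi>) \<Upsilon> p \<longrightarrow> ereal (log 2 (real p)) \<le> sharp \<xi> \<theta> + 1 \<longrightarrow>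
        good \<xi> \<Upsilon> (sharp \<xi> \<theta> / 2))"

definition E_stable :: "('f, 'r, 'p) configuration \<Rightarrow> bool" where
  "E_stable \<xi> \<longleftrightarrow>
     (\<forall>\<theta>\<in>RE_Class \<xi>. \<forall>\<Upsilon>\<in>Sigma_sent \<xi> 1. \<forall>p.
        proof_of \<xi> (\<theta> \<union> base \<xi>) \<Upsilon> p \<longrightarrow> ereal (log 2 (real p)) \<le> sharp \<xi> \<theta> + 1 \<longrightarrow>
        good \<xi> \<Upsilon> (ereal (real_of_int \<lfloor>log 2 (real p)\<rfloor> / 2 - 1)))"

definition EA_stable :: "('f, 'r, 'p) configuration \<Rightarrow> bool" where
  "EA_stable \<xi> \<longleftrightarrow> E_stable \<xi> \<and> A_stable \<xi>"


section \<open>Self-consistency axioms\<close>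

definition is_Neg :: "('f, 'r, 'p) configuration \<Rightarrow> nat \<Rightarrow> ('f, 'r) fm \<Rightarrow> bool" where
  "is_Neg \<xi> k \<nu> \<longleftrightarrow> \<nu> \<in> Delta0 \<xi> \<and> wf_fm (lang \<xi>) 2 \<nu> \<and>
     (\<forall>x y. holds_std (lang \<xi>) \<nu> [x, y] \<longleftrightarrow>
        (\<exists>\<Psi>\<in>Pi_sent \<xi> k. x = gn \<xi> \<Psi> \<and> y = gn \<xi> (prenex_neg \<Psi>)))"

definition is_SubstPrf ::
    "('f, 'r, 'p) configuration \<Rightarrow> ('f, 'r) fm set \<Rightarrow> ('f, 'r) fm \<Rightarrow> bool" where
  "is_SubstPrf \<xi> \<beta> \<sigma> \<longleftrightarrow> \<sigma> \<in> Delta0 \<xi> \<and> wf_fm (lang \<xi>) 3 \<sigma> \<and>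
     (\<forall>g t p. holds_std (lang \<xi>) \<sigma> [g, t, p] \<longleftrightarrow>
        (\<exists>\<phi>\<in>formulas (lang \<xi>). \<exists>X\<in>sentences (lang \<xi>). g = gn \<xi> \<phi> \<and> t = gn \<xi> X \<and>
           proof_of \<xi> (\<beta> \<union> {subst (\<lambda>_. numl \<xi> g) \<phi>}) X p))"

text \<open>The formula \<open>\<Gamma>(g)\<close>, with \<open>g\<close> its only free variable, built from \<open>\<nu> = Neg\<^sup>k\<close> and
  \<open>\<sigma> = SubstPrf\<close>. Inside the four quantifiers \<open>\<forall>x \<forall>y \<forall>p \<forall>q\<close> the variables
  \<open>g, x, y, p, q\<close> have the indices \<open>4, 3, 2, 1, 0\<close>.\<close>

definition Gamma_fm :: "('f, 'r) fm \<Rightarrow> ('f, 'r) fm \<Rightarrow> ('f, 'r) fm" where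
  "Gamma_fm \<nu> \<sigma> = Forall (Forall (Forall (Forall (Neg
     (Conj (inst \<nu> [Var 3, Var 2])
     (Conj (inst \<sigma> [Var 4, Var 3, Var 1]) (inst \<sigma> [Var 4, Var 2, Var 0])))))))"

definition selfcons ::
    "('f, 'r, 'p) configuration \<Rightarrow> ('f, 'r) fm \<Rightarrow> ('f, 'r) fm \<Rightarrow> ('f, 'r) fm" where
  "selfcons \<xi> \<nu> \<sigma> = inst (Gamma_fm \<nu> \<sigma>) [numl \<xi> (gn \<xi> (Gamma_fm \<nu> \<sigma>))]"

text \<open>\<open>Prf\<^sub>\<alpha>(t, p)\<close> for \<open>\<alpha> = \<beta> + selfcons\<close>: with \<open>n\<close> the code of \<open>\<Gamma>\<close>, the sentence obtained from the
  formula with code \<open>n\<close> by replacing its free variable by the numeral of \<open>n\<close> is \<open>selfcons\<close> itself, so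
  \<open>SubstPrf(n, t, p)\<close> says that \<open>p\<close> is a proof of \<open>t\<close> from \<open>\<alpha>\<close>.\<close>

definition Prf_alpha ::
    "('f, 'r, 'p) configuration \<Rightarrow> ('f, 'r) fm \<Rightarrow> ('f, 'r) fm \<Rightarrow> 'f trm \<Rightarrow> 'f trm \<Rightarrow> ('f, 'r) fm" where
  "Prf_alpha \<xi> \<nu> \<sigma> t p = inst \<sigma> [numl \<xi> (gn \<xi> (Gamma_fm \<nu> \<sigma>)), t, p]"


section \<open>Translations\<close>

definition translation ::
    "('f, 'r, 'p) configuration \<Rightarrow> (('f, 'r) fm \<Rightarrow> ('f, 'r) fm) \<Rightarrow> bool" where
  "translation \<xi> T \<longleftrightarrow>
     (\<forall>\<Psi>\<in>Pi_sent \<xi> 1. T \<Psi> \<in> Pi_sent \<xi> 1 \<and> (true_std (lang \<xi>) (T \<Psi>) \<longleftrightarrow> true_std (lang \<xi>) \<Psi>)) \<and>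
     (\<exists>f. recursive 1 f \<and> (\<forall>\<Psi>\<in>Pi_sent \<xi> 1. f [gn \<xi> \<Psi>] = gn \<xi> (T \<Psi>)))"

end

theory Submission
  imports Defs
begin

text \<open>
  Take for \<open>\<Psi>\<^sup>T\<close> the statement that no proof from \<open>\<alpha>\<close> proves the negation of \<open>\<Psi>\<close>. That a proof of
  \<open>\<Psi>\<close> from \<open>\<alpha>\<close> implies \<open>\<Psi>\<^sup>T\<close> is then an instance of the self-consistency axiom. If \<open>\<Psi>\<close> is false, its
  negation is a true \<open>\<Sigma>\<^sub>1\<close> sentence, hence provable from the base axioms, so \<open>\<Psi>\<^sup>T\<close> is false. If \<open>\<Psi>\<close> is
  true, \<open>\<Psi>\<^sup>T\<close> holds because \<open>\<alpha>\<close> is sound, and this is where stability enters: the self-consistency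
  axiom is true, since a least pair of contradictory proofs would be short enough for EA-stability.
\<close>

section \<open>Substitution\<close>

lemma subst_trm_cong:
  "wf_trm L n t \<Longrightarrow> (\<And>i. i < n \<Longrightarrow> s i = s' i) \<Longrightarrow> subst_trm s t = subst_trm s' t"
  by (induction t) (auto simp: list_all_iff)

lemma lift_subst_cong:
  "(\<And>i. i < n \<Longrightarrow> s i = s' i) \<Longrightarrow> i < Suc n \<Longrightarrow> lift_subst s i = lift_subst s' i"
  by (simp add: lift_subst_def split: nat.splits)

text \<open>\<open>inst\<close> leaves the variables beyond its list in place, while
  \<open>is_SubstPrf\<close> puts a numeral for every variable; this makes the two comparable on a
  formula with few free variables.\<close>

lemma subst_cong:
  "wf_fm L n \<phi> \<Longrightarrow> (\<And>i. i < n \<Longrightarrow> s i = s' i) \<Longrightarrow> subst s \<phi> = subst s' \<phi>"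
proof (induction \<phi> arbitrary: n s s')
  case (Rel r ts)
  then show ?case using subst_trm_cong[of L n _ s s'] by (simp add: list_all_iff)
next
  case (Forall \<phi>)
  have "subst (lift_subst s) \<phi> = subst (lift_subst s') \<phi>"
    using Forall.prems by (intro Forall.IH[of "Suc n"] lift_subst_cong[of n]) auto
  then show ?case by simp
next
  case (Exists \<phi>)
  have "subst (lift_subst s) \<phi> = subst (lift_subst s') \<phi>"
    using Exists.prems by (intro Exists.IH[of "Suc n"] lift_subst_cong[of n]) auto
  then show ?case by simp
next
  case (BForall t \<phi>)
  have "subst (lift_subst s) \<phi> = subst (lift_subst s') \<phi>"
    using BForall.prems by (intro BForall.IH[of "Suc n"] lift_subst_cong[of n]) auto
  moreover have "subst_trm s t = subst_trm s' t"
    using BForall.prems by (intro subst_trm_cong[of L n]) auto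
  ultimately show ?case by simp
next
  case (BExists t \<phi>)
  have "subst (lift_subst s) \<phi> = subst (lift_subst s') \<phi>"
    using BExists.prems by (intro BExists.IH[of "Suc n"] lift_subst_cong[of n]) auto
  moreover have "subst_trm s t = subst_trm s' t"
    using BExists.prems by (intro subst_trm_cong[of L n]) auto
  ultimately show ?case by simp
next
  case (Eq t u)
  then show ?case using subst_trm_cong[of L n _ s s'] by simp
next
  case (Leq t u)
  then show ?case using subst_trm_cong[of L n _ s s'] by simp
next
  case (Neg \<phi>)
  then show ?case by (metis subst.simps(4) wf_fm.simps(4))
next
  case (Conj \<phi> \<psi>)
  then show ?case by (metis subst.simps(5) wf_fm.simps(5))
next
  case (Disj \<phi> \<psi>)
  then show ?case by (metis subst.simps(6) wf_fm.simps(6))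
next
  case (Imp \<phi> \<psi>)
  then show ?case by (metis subst.simps(7) wf_fm.simps(7))
qed

section \<open>Well-formedness under substitution\<close>

lemma wf_trm_mono: "wf_trm L m t \<Longrightarrow> m \<le> n \<Longrightarrow> wf_trm L n t"
  by (induction t) (auto simp: list_all_iff)

lemma wf_trm_subst:
  "wf_trm L m t \<Longrightarrow> (\<And>i. i < m \<Longrightarrow> wf_trm L n (s i)) \<Longrightarrow> wf_trm L n (subst_trm s t)"
  by (induction t) (auto simp: list_all_iff)

lemma wf_trm_shift: "wf_trm L n t \<Longrightarrow> wf_trm L (Suc n) (subst_trm (\<lambda>j. Var (Suc j)) t)"
  by (rule wf_trm_subst) auto

lemma wf_trm_lift:
  "(\<And>i. i < m \<Longrightarrow> wf_trm L n (s i)) \<Longrightarrow> i < Suc m \<Longrightarrow> wf_trm L (Suc n) (lift_subst s i)"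
  by (auto simp: lift_subst_def split: nat.splits intro: wf_trm_shift)

lemma wf_fm_subst:
  "wf_fm L m \<phi> \<Longrightarrow> (\<And>i. i < m \<Longrightarrow> wf_trm L n (s i)) \<Longrightarrow> wf_fm L n (subst s \<phi>)"
proof (induction \<phi> arbitrary: m n s)
  case (Forall \<phi>)
  have "wf_fm L (Suc n) (subst (lift_subst s) \<phi>)"
    using Forall.prems by (intro Forall.IH[of "Suc m"] wf_trm_lift[of m]) auto
  then show ?case by simp
next
  case (Exists \<phi>)
  have "wf_fm L (Suc n) (subst (lift_subst s) \<phi>)"
    using Exists.prems by (intro Exists.IH[of "Suc m"] wf_trm_lift[of m]) auto
  then show ?case by simp
next
  case (BForall t \<phi>)
  have "wf_fm L (Suc n) (subst (lift_subst s) \<phi>)"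
    using BForall.prems by (intro BForall.IH[of "Suc m"] wf_trm_lift[of m]) auto
  with BForall.prems show ?case by (auto intro: wf_trm_subst)
next
  case (BExists t \<phi>)
  have "wf_fm L (Suc n) (subst (lift_subst s) \<phi>)"
    using BExists.prems by (intro BExists.IH[of "Suc m"] wf_trm_lift[of m]) auto
  with BExists.prems show ?case by (auto intro: wf_trm_subst)
qed (auto simp: list_all_iff intro: wf_trm_subst)

lemma wf_fm_inst:
  "wf_fm L (length ts) \<phi> \<Longrightarrow> (\<And>t. t \<in> set ts \<Longrightarrow> wf_trm L n t) \<Longrightarrow> wf_fm L n (inst \<phi> ts)"
  unfolding inst_def by (rule wf_fm_subst) auto

text \<open>Closure of \<open>Delta0\<close> under substitution asks for some \<open>n\<close> per
  term; that condition has to survive when a substitution passes below a quantifier.\<close>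

lemma ex_wf_lift_subst:
  assumes "\<And>i. \<exists>n. wf_trm L n (s i)"
  shows "\<exists>n. wf_trm L n (lift_subst s i)"
proof (cases i)
  case 0
  then show ?thesis by (auto simp: lift_subst_def)
next
  case (Suc j)
  obtain n where "wf_trm L n (s j)" using assms by blast
  then have "wf_trm L (Suc n) (lift_subst s i)"
    using Suc by (simp add: lift_subst_def wf_trm_shift)
  then show ?thesis ..
qed

section \<open>Substitution and environments in a structure\<close>

lemma val_subst: "val M e (subst_trm s t) = val M (\<lambda>i. val M e (s i)) t"
  by (induction t) (auto simp: comp_def cong: map_cong)

lemma val_lift_subst [simp]:
  "val M (case_nat a e) (lift_subst s i) = case_nat a (\<lambda>j. val M e (s j)) i"
  by (auto simp: lift_subst_def val_subst split: nat.splits)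

lemma sat_subst: "sat M e (subst s \<phi>) = sat M (\<lambda>i. val M e (s i)) \<phi>"
  by (induction \<phi> arbitrary: e s) (simp_all add: val_subst comp_def cong: map_cong)

lemma val_cong:
  "wf_trm L n t \<Longrightarrow> (\<And>i. i < n \<Longrightarrow> e i = e' i) \<Longrightarrow> val M e t = val M e' t"
proof (induction t)
  case (Fn f ts)
  then have "map (val M e) ts = map (val M e') ts"
    by (auto simp: list_all_iff)
  then show ?case by (simp del: map_eq_conv)
qed simp

lemma sat_cong:
  "wf_fm L n \<phi> \<Longrightarrow> (\<And>i. i < n \<Longrightarrow> e i = e' i) \<Longrightarrow> sat M e \<phi> = sat M e' \<phi>"
proof (induction \<phi> arbitrary: n e e')
  case (Eq t u)
  then show ?case using val_cong[of L n _ e e' M] by simp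
next
  case (Leq t u)
  then show ?case using val_cong[of L n _ e e' M] by simp
next
  case (Rel r ts)
  then have "map (val M e) ts = map (val M e') ts"
    using val_cong[of L n _ e e' M] by (auto simp: list_all_iff)
  then show ?case by (simp del: map_eq_conv)
next
  case (Forall \<phi>)
  have "sat M (case_nat a e) \<phi> = sat M (case_nat a e') \<phi>" for a
    using Forall.prems by (intro Forall.IH[where n = "Suc n"]) (auto split: nat.splits)
  then show ?case by simp
next
  case (Exists \<phi>)
  have "sat M (case_nat a e) \<phi> = sat M (case_nat a e') \<phi>" for a
    using Exists.prems by (intro Exists.IH[where n = "Suc n"]) (auto split: nat.splits)
  then show ?case by simp
next
  case (BForall t \<phi>)
  have "sat M (case_nat a e) \<phi> = sat M (case_nat a e') \<phi>" for a
    using BForall.prems by (intro BForall.IH[where n = "Suc n"]) (auto split: nat.splits)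
  moreover have "val M e t = val M e' t"
    using BForall.prems by (auto intro: val_cong)
  ultimately show ?case by simp
next
  case (BExists t \<phi>)
  have "sat M (case_nat a e) \<phi> = sat M (case_nat a e') \<phi>" for a
    using BExists.prems by (intro BExists.IH[where n = "Suc n"]) (auto split: nat.splits)
  moreover have "val M e t = val M e' t"
    using BExists.prems by (auto intro: val_cong)
  ultimately show ?case by simp
next
  case (Neg \<phi>)
  then show ?case by (metis sat.simps(4) wf_fm.simps(4))
next
  case (Conj \<phi> \<psi>)
  then show ?case by (metis sat.simps(5) wf_fm.simps(5))
next
  case (Disj \<phi> \<psi>)
  then show ?case by (metis sat.simps(6) wf_fm.simps(6))
next
  case (Imp \<phi> \<psi>)
  then show ?case by (metis sat.simps(7) wf_fm.simps(7))
qed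

text \<open>\<open>(!)\<close> of a list serves as an environment: its unspecified values beyond the
  list do not matter, because \<open>wf_fm\<close> bounds the free variables.\<close>

lemma sat_inst:
  assumes "wf_fm L (length ts) \<phi>"
  shows "sat M e (inst \<phi> ts) = sat M ((!) (map (val M e) ts)) \<phi>"
  unfolding inst_def sat_subst by (rule sat_cong[OF assms]) simp

lemma holds_std_iff:
  assumes "wf_fm L (length as) \<phi>"
  shows "holds_std L \<phi> as = sat (standard_model L) ((!) as) \<phi>"
  unfolding holds_std_def by (rule sat_cong[OF assms]) simp

lemma true_std_sentence:
  "\<phi> \<in> sentences L \<Longrightarrow> true_std L \<phi> = sat (standard_model L) e \<phi>"
  unfolding true_std_def sentences_def by (metis mem_Collect_eq not_less_zero sat_cong)

text \<open>Quantifiers range over \<open>dom M\<close> only, so instantiating one at a numeral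
  requires the value of the numeral to lie there.\<close>

lemma val_closed_in_dom:
  "structure_for L M \<Longrightarrow> wf_trm L 0 t \<Longrightarrow> val M e t \<in> dom M"
  by (induction t) (auto simp: structure_for_def list_all_iff image_subset_iff)

lemma dom_standard_model [simp]: "dom (standard_model L) = UNIV"
  and le_standard_model [simp]: "le (standard_model L) = (\<le>)"
  by (simp_all add: standard_model_def)

lemma structure_for_standard_model: "structure_for L (standard_model L)"
  by (simp add: structure_for_def)


section \<open>Prenex negation\<close>

lemma sat_prenex_neg: "sat M e (prenex_neg \<phi>) \<longleftrightarrow> \<not> sat M e \<phi>"
  by (induction \<phi> arbitrary: e rule: prenex_neg.induct) auto

lemma wf_prenex_neg: "wf_fm L n (prenex_neg \<phi>) = wf_fm L n \<phi>"
  by (induction \<phi> arbitrary: n rule: prenex_neg.induct) auto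

lemma prenex_neg_bounded: "fully_bounded \<phi> \<Longrightarrow> prenex_neg \<phi> = Neg \<phi>"
  by (cases \<phi>) auto

lemma prenex_neg_Foralls:
  "fully_bounded \<phi> \<Longrightarrow> prenex_neg ((Forall ^^ k) \<phi>) = (Exists ^^ k) (Neg \<phi>)"
  by (induction k) (auto simp: prenex_neg_bounded)

lemma scope_bounded: "fully_bounded \<phi> \<Longrightarrow> scope E \<phi> = \<phi>"
  by (cases \<phi>) auto

text \<open>As \<open>b \<le> a\<close>, witnesses below \<open>b\<close> for the negation also lie
  in the range of the bounded universal prefix and refute it.\<close>

lemma sat_scope_prenex_neg:
  assumes "\<And>e. val (standard_model L) e E = a" "\<And>e. val (standard_model L) e E' = b" "b \<le> a"
    and "fully_bounded \<phi>"
    and "sat (standard_model L) e (scope E ((Forall ^^ k) \<phi>))"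
  shows "\<not> sat (standard_model L) e (scope E' (prenex_neg ((Forall ^^ k) \<phi>)))"
  using assms(5)
proof (induction k arbitrary: e)
  case 0
  then show ?case using assms(4) by (simp add: prenex_neg_bounded scope_bounded)
next
  case (Suc k)
  then show ?case using assms(1-3) by fastforce
qed


section \<open>Recursive functions\<close>

lemma recursive_const: "recursive n (\<lambda>xs. c)"
proof (induction c)
  case (Suc c)
  have "recursive (length [\<lambda>xs :: nat list. c]) (\<lambda>xs. Suc (xs ! 0))"
    using rec_suc by simp
  from rec_comp[OF this, of n] Suc show ?case by simp
qed (rule rec_zero)

text \<open>With \<open>c\<close> the code of one fixed formula, this turns the recursive
  substitution on codes into a function of the substituted number alone.\<close>

lemma recursive_fix_first:
  assumes "recursive 2 f"
  shows "recursive 1 (\<lambda>xs. f [c, xs ! 0])"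
proof -
  have "recursive (length [\<lambda>xs :: nat list. c, \<lambda>xs. xs ! 0]) f"
    using assms by (simp add: numeral_2_eq_2)
  from rec_comp[OF this, of 1] show ?thesis
    by (simp add: recursive_const rec_proj)
qed

text \<open>Lets stability be applied to the set whose only element is the self-consistency
  axiom.\<close>

lemma rec_enumerable_singleton: "rec_enumerable {c}"
  unfolding rec_enumerable_def using recursive_const[of 1 c] by (auto intro!: exI[of _ "\<lambda>_. c"])


section \<open>The self-consistency axiom\<close>

lemma log_le_floor_log:
  fixes p m :: nat
  assumes "p \<le> m" "m \<ge> 1"
  shows "log 2 p \<le> of_int \<lfloor>log 2 m\<rfloor> + 1" "\<lfloor>log 2 p\<rfloor> \<le> \<lfloor>log 2 m\<rfloor>"
proof -
  \<comment> \<open>The code \<open>p\<close> may be \<open>0\<close>, where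
    \<open>log 2 0 = 0\<close>; this is at most \<open>log 2 m\<close> since
    \<open>m \<ge> 1\<close>.\<close>
  have *: "log 2 p \<le> log 2 m"
    using assms by (cases "p = 0") (auto simp: log_le_cancel_iff log_def[of 2 0])
  then show "log 2 p \<le> of_int \<lfloor>log 2 m\<rfloor> + 1" by linarith
  from * show "\<lfloor>log 2 p\<rfloor> \<le> \<lfloor>log 2 m\<rfloor>" by (rule floor_mono)
qed

locale self_justifying =
  fixes \<xi> :: "('f, 'r, 'p) configuration" and \<nu> \<sigma> :: "('f, 'r) fm"
  assumes gc: "generic_configuration \<xi>"
    and nu: "is_Neg \<xi> 1 \<nu>"
    and sg: "is_SubstPrf \<xi> (base \<xi>) \<sigma>"
begin

abbreviation "L \<equiv> lang \<xi>"
abbreviation "N \<equiv> standard_model L"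
abbreviation "\<Gamma> \<equiv> Gamma_fm \<nu> \<sigma>"
abbreviation "S \<equiv> selfcons \<xi> \<nu> \<sigma>"
abbreviation "\<alpha> \<equiv> base \<xi> \<union> {S}"

section \<open>Clauses of a generic configuration\<close>

lemma gc_language: "generic_language L" and gc_Delta0: "generic_Delta0 L (Delta0 \<xi>)"
  and gc_base: "generic_base \<xi>" and gc_ded: "conventional_ded \<xi>"
  and gc_encoding: "goedel_encoding L (enc \<xi>)"
  using gc by (simp_all add: generic_configuration_def)

lemmas base_true = gc_base[unfolded generic_base_def, THEN conjunct1, rule_format]

lemmas Sigma_complete =
  gc_base[unfolded generic_base_def, THEN conjunct2, THEN conjunct1, rule_format]

lemmas ded_sound = gc_ded[unfolded conventional_ded_def, THEN conjunct1, rule_format]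

lemmas ded_axiom =
  gc_ded[unfolded conventional_ded_def, THEN conjunct2, THEN conjunct1, rule_format]

lemmas ded_mono =
  gc_ded[unfolded conventional_ded_def, THEN conjunct2, THEN conjunct2, THEN conjunct1, rule_format]

lemmas ded_valid =
  gc_ded[unfolded conventional_ded_def, THEN conjunct2, THEN conjunct2, THEN conjunct2,
    THEN conjunct1, rule_format]

lemmas ded_indirect_implication =
  gc_ded[unfolded conventional_ded_def, THEN conjunct2, THEN conjunct2, THEN conjunct2,
    THEN conjunct2, rule_format]

lemma numeral_std:
  "wf_trm L 0 (numl \<xi> k)" "val N e (numl \<xi> k) = k"
  using gc_language unfolding generic_language_def by blast+

lemma wf_numl [simp]: "wf_trm L n (numl \<xi> k)"
  using numeral_std(1) wf_trm_mono by blast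

text \<open>A numeral is closed, so the choice of environment is immaterial. \<open>M\<close> is
  arbitrary because provability is later reduced to validity.\<close>

definition closed_val :: "('u, 'f, 'r) struct \<Rightarrow> nat \<Rightarrow> 'u" where
  "closed_val M k = val M (\<lambda>_. undefined) (numl \<xi> k)"

lemma val_numl [simp]: "val M e (numl \<xi> k) = closed_val M k"
  unfolding closed_val_def by (rule val_cong[OF wf_numl[of 0]]) simp

lemma closed_val_std [simp]: "closed_val N k = k"
  unfolding closed_val_def by (rule numeral_std)

lemma wf_nu: "wf_fm L 2 \<nu>" and wf_sg: "wf_fm L 3 \<sigma>"
  using nu sg by (auto simp: is_Neg_def is_SubstPrf_def)

lemma sat_nu [simp]: "sat M e (inst \<nu> [s, t]) = sat M ((!) [val M e s, val M e t]) \<nu>"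
  using sat_inst[of L "[s, t]"] wf_nu by (simp add: numeral_2_eq_2)

lemma sat_sg [simp]:
  "sat M e (inst \<sigma> [s, t, u]) = sat M ((!) [val M e s, val M e t, val M e u]) \<sigma>"
  using sat_inst[of L "[s, t, u]"] wf_sg by (simp add: numeral_3_eq_3)

lemma wf_inst_nu: "wf_trm L n s \<Longrightarrow> wf_trm L n t \<Longrightarrow> wf_fm L n (inst \<nu> [s, t])"
  using wf_fm_inst[of L "[s, t]"] wf_nu by (auto simp: numeral_2_eq_2)

lemma wf_inst_sg:
  "wf_trm L n s \<Longrightarrow> wf_trm L n t \<Longrightarrow> wf_trm L n u \<Longrightarrow> wf_fm L n (inst \<sigma> [s, t, u])"
  using wf_fm_inst[of L "[s, t, u]"] wf_sg by (auto simp: numeral_3_eq_3)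

lemma wf_Gamma: "wf_fm L 1 \<Gamma>"
  by (auto simp: Gamma_fm_def intro!: wf_inst_nu wf_inst_sg)

lemma Gamma_formula: "\<Gamma> \<in> formulas L"
  using wf_Gamma by (auto simp: formulas_def)

text \<open>The diagonal step: \<open>is_SubstPrf\<close> at the code of \<open>\<Gamma>\<close>
  adjoins exactly \<open>S\<close>, since only variable 0 is free in
  \<open>\<Gamma>\<close>.\<close>

lemma subst_Gamma: "subst (\<lambda>_. numl \<xi> (gn \<xi> \<Gamma>)) \<Gamma> = S"
  unfolding selfcons_def inst_def by (rule subst_cong[OF wf_Gamma]) simp

section \<open>Closure of the bounded class and first-level sentences\<close>

lemma Delta0_Neg: "\<phi> \<in> Delta0 \<xi> \<Longrightarrow> Neg \<phi> \<in> Delta0 \<xi>"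
  and Delta0_Conj: "\<phi> \<in> Delta0 \<xi> \<Longrightarrow> \<psi> \<in> Delta0 \<xi> \<Longrightarrow> Conj \<phi> \<psi> \<in> Delta0 \<xi>"
  and Delta0_subst: "\<phi> \<in> Delta0 \<xi> \<Longrightarrow> (\<And>i. \<exists>n. wf_trm L n (s i)) \<Longrightarrow> subst s \<phi> \<in> Delta0 \<xi>"
  and Delta0_bounded: "\<phi> \<in> Delta0 \<xi> \<Longrightarrow> fully_bounded \<phi>"
  using gc_Delta0 by (simp_all add: generic_Delta0_def)

lemma Delta0_inst:
  assumes "\<phi> \<in> Delta0 \<xi>" "\<And>t. t \<in> set ts \<Longrightarrow> \<exists>n. wf_trm L n t"
  shows "inst \<phi> ts \<in> Delta0 \<xi>"
  unfolding inst_def using assms by (intro Delta0_subst) auto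

lemma ex_wf_Var: "\<exists>n. wf_trm L n (Var i)"
  by auto

lemma ex_wf_numl: "\<exists>n. wf_trm L n (numl \<xi> k)"
  using wf_numl by blast

lemma Delta0_nu: "\<nu> \<in> Delta0 \<xi>" and Delta0_sg: "\<sigma> \<in> Delta0 \<xi>"
  using nu sg by (auto simp: is_Neg_def is_SubstPrf_def)

lemma Pi_sentI:
  "(Forall ^^ k) \<phi> \<in> sentences L \<Longrightarrow> \<phi> \<in> Delta0 \<xi> \<Longrightarrow> (Forall ^^ k) \<phi> \<in> Pi_sent \<xi> 1"
  by (auto simp: Pi_sent_def)

lemma Pi_sentE:
  assumes "\<Psi> \<in> Pi_sent \<xi> 1"
  obtains k \<phi> where "\<Psi> = (Forall ^^ k) \<phi>" "\<phi> \<in> Delta0 \<xi>"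
  using assms by (auto simp: Pi_sent_def)

lemma Pi_sent_sentence: "\<Psi> \<in> Pi_sent \<xi> 1 \<Longrightarrow> \<Psi> \<in> sentences L"
  by (simp add: Pi_sent_def)

lemma sentence_formula: "\<Psi> \<in> sentences L \<Longrightarrow> \<Psi> \<in> formulas L"
  by (auto simp: sentences_def formulas_def)

lemma prenex_neg_sentence: "\<Psi> \<in> sentences L \<Longrightarrow> prenex_neg \<Psi> \<in> sentences L"
  by (simp add: sentences_def wf_prenex_neg)

lemma prenex_neg_Sigma:
  assumes "\<Psi> \<in> Pi_sent \<xi> 1"
  shows "prenex_neg \<Psi> \<in> Sigma_sent \<xi> 1"
proof -
  obtain k \<phi> where "\<Psi> = (Forall ^^ k) \<phi>" "\<phi> \<in> Delta0 \<xi>" using assms by (rule Pi_sentE)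
  then have "prenex_neg \<Psi> = (Exists ^^ k) (Neg \<phi>)" "Neg \<phi> \<in> Delta0 \<xi>"
    by (auto simp: prenex_neg_Foralls Delta0_bounded Delta0_Neg)
  then have "prenex_neg \<Psi> \<in> Sigma_class \<xi> 1" by auto
  then show ?thesis
    using assms by (simp add: Sigma_sent_def Pi_sent_sentence prenex_neg_sentence)
qed

lemma selfcons_sentence: "S \<in> sentences L"
  unfolding sentences_def selfcons_def inst_def
  using wf_fm_subst[OF wf_Gamma] by simp

lemma selfcons_Pi: "S \<in> Pi_sent \<xi> 1"
proof -
  let ?s = "\<lambda>i. if i < length [numl \<xi> (gn \<xi> \<Gamma>)] then [numl \<xi> (gn \<xi> \<Gamma>)] ! i else Var i"
  let ?m = "Neg (Conj (inst \<nu> [Var 3, Var 2])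
     (Conj (inst \<sigma> [Var 4, Var 3, Var 1]) (inst \<sigma> [Var 4, Var 2, Var 0])))"
  \<comment> \<open>Pushing the instantiation below four quantifiers lifts it four times; this
    displays \<open>S\<close> as a universal prefix over a \<open>Delta0\<close> matrix.\<close>
  have eq: "S = (Forall ^^ 4)
      (subst (lift_subst (lift_subst (lift_subst (lift_subst ?s)))) ?m)"
    unfolding selfcons_def inst_def[of \<Gamma>] by (simp add: Gamma_fm_def numeral_eq_Suc)
  have "?m \<in> Delta0 \<xi>"
    by (intro Delta0_Neg Delta0_Conj Delta0_inst Delta0_nu Delta0_sg) (auto intro: ex_wf_Var)
  then have m: "subst (lift_subst (lift_subst (lift_subst (lift_subst ?s)))) ?m \<in> Delta0 \<xi>"
    by (rule Delta0_subst) (intro ex_wf_lift_subst, auto intro: ex_wf_Var ex_wf_numl)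
  show ?thesis
    by (subst eq, rule Pi_sentI[OF _ m], fold eq, rule selfcons_sentence)
qed

text \<open>Stated for every structure, where \<open>\<nu>\<close> and \<open>\<sigma>\<close> need
  not mean what they define in the standard model: the proof of reflection relies on this form of
  \<open>S\<close> alone.\<close>

lemma sat_selfcons:
  "sat M e S \<longleftrightarrow> (\<forall>x\<in>dom M. \<forall>y\<in>dom M. \<forall>p\<in>dom M. \<forall>q\<in>dom M.
     \<not> (sat M ((!) [x, y]) \<nu> \<and> sat M ((!) [closed_val M (gn \<xi> \<Gamma>), x, p]) \<sigma> \<and>
        sat M ((!) [closed_val M (gn \<xi> \<Gamma>), y, q]) \<sigma>))"
  unfolding selfcons_def inst_def[of \<Gamma>] sat_subst
  by (simp add: Gamma_fm_def)

section \<open>The coding formulas in the standard model\<close>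

lemma gn_inj: "\<phi> \<in> formulas L \<Longrightarrow> \<psi> \<in> formulas L \<Longrightarrow> gn \<xi> \<phi> = gn \<xi> \<psi> \<longleftrightarrow> \<phi> = \<psi>"
  using gc_encoding by (auto simp: goedel_encoding_def dest: inj_onD)

lemma nu_std:
  "sat N ((!) [x, y]) \<nu> \<longleftrightarrow> (\<exists>\<Psi>\<in>Pi_sent \<xi> 1. x = gn \<xi> \<Psi> \<and> y = gn \<xi> (prenex_neg \<Psi>))"
  using nu holds_std_iff[of L "[x, y]" \<nu>] wf_nu
  by (simp add: is_Neg_def numeral_2_eq_2)

text \<open>Injectivity of \<open>gn\<close> leaves \<open>\<Gamma>\<close> and \<open>X\<close> as
  the only candidates for the given codes, and by \<open>subst_Gamma\<close> the adjoined sentence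
  is \<open>S\<close>.\<close>

lemma sg_std:
  assumes "X \<in> sentences L"
  shows "sat N ((!) [gn \<xi> \<Gamma>, gn \<xi> X, p]) \<sigma> \<longleftrightarrow> proof_of \<xi> \<alpha> X p"
proof -
  have "sat N ((!) [gn \<xi> \<Gamma>, gn \<xi> X, p]) \<sigma> \<longleftrightarrow> holds_std L \<sigma> [gn \<xi> \<Gamma>, gn \<xi> X, p]"
    using holds_std_iff[of L "[gn \<xi> \<Gamma>, gn \<xi> X, p]" \<sigma>] wf_sg by (simp add: numeral_3_eq_3)
  also have "\<dots> \<longleftrightarrow> (\<exists>\<phi>\<in>formulas L. \<exists>Y\<in>sentences L. gn \<xi> \<Gamma> = gn \<xi> \<phi> \<and> gn \<xi> X = gn \<xi> Y \<and>
       proof_of \<xi> (base \<xi> \<union> {subst (\<lambda>_. numl \<xi> (gn \<xi> \<Gamma>)) \<phi>}) Y p)"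
    using sg by (simp add: is_SubstPrf_def)
  also have "\<dots> \<longleftrightarrow> proof_of \<xi> \<alpha> X p"
    using assms Gamma_formula subst_Gamma gn_inj sentence_formula by (metis (no_types, lifting))
  finally show ?thesis .
qed

text \<open>A counterexample to \<open>S\<close> in the standard model. The codes \<open>x\<close>
  and \<open>y\<close> are kept as arguments because goodness bounds them as well as
  \<open>p\<close> and \<open>q\<close>.\<close>

definition violation :: "nat \<Rightarrow> nat \<Rightarrow> nat \<Rightarrow> nat \<Rightarrow> bool" where
  "violation x y p q \<longleftrightarrow> (\<exists>\<Psi>\<in>Pi_sent \<xi> 1. x = gn \<xi> \<Psi> \<and> y = gn \<xi> (prenex_neg \<Psi>) \<and>
     proof_of \<xi> \<alpha> \<Psi> p \<and> proof_of \<xi> \<alpha> (prenex_neg \<Psi>) q)"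

lemma violation_iff:
  "sat N ((!) [x, y]) \<nu> \<and> sat N ((!) [gn \<xi> \<Gamma>, x, p]) \<sigma> \<and> sat N ((!) [gn \<xi> \<Gamma>, y, q]) \<sigma>
     \<longleftrightarrow> violation x y p q"
  using sg_std Pi_sent_sentence prenex_neg_sentence
  unfolding violation_def nu_std by blast

lemma sat_std_selfcons: "sat N e S \<longleftrightarrow> (\<forall>x y p q. \<not> violation x y p q)"
  by (simp add: sat_selfcons violation_iff)

lemma val_E_term: "val N e (E_term \<xi> r) = nat \<lceil>2 powr r\<rceil>"
  by (simp add: E_term_def)

text \<open>Removes the ceiling that \<open>E_term\<close> introduces for fractional or negative
  exponents.\<close>

lemma less_ceiling_powr: "x < nat \<lceil>2 powr r\<rceil> \<longleftrightarrow> real x < 2 powr r"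
  by linarith

lemma sat_scope_selfcons:
  "sat N e (scope (E_term \<xi> r) S) \<longleftrightarrow>
     (\<forall>x y p q. real x < 2 powr r \<longrightarrow> real y < 2 powr r \<longrightarrow> real p < 2 powr r \<longrightarrow>
        real q < 2 powr r \<longrightarrow> \<not> violation x y p q)"
proof -
  have "sat N e (scope (E_term \<xi> r) S) \<longleftrightarrow>
     (\<forall>x < nat \<lceil>2 powr r\<rceil>. \<forall>y < nat \<lceil>2 powr r\<rceil>. \<forall>p < nat \<lceil>2 powr r\<rceil>. \<forall>q < nat \<lceil>2 powr r\<rceil>.
        \<not> violation x y p q)"
    unfolding selfcons_def inst_def[of \<Gamma>]
    \<comment> \<open>The scope bounds appear as \<open>\<le>\<close> together with
      \<open>\<noteq>\<close>; \<open>less_le\<close> read backwards turns them into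
      \<open><\<close>.\<close>
    by (simp add: Gamma_fm_def val_E_term sat_subst flip: violation_iff less_le)
  then show ?thesis by (auto simp: less_ceiling_powr)
qed

lemma good_selfcons:
  "good \<xi> S (ereal r) \<longleftrightarrow>
     (\<forall>x y p q. real x < 2 powr r \<longrightarrow> real y < 2 powr r \<longrightarrow> real p < 2 powr r \<longrightarrow>
        real q < 2 powr r \<longrightarrow> \<not> violation x y p q)"
  by (simp add: good_def true_std_def sat_scope_selfcons)

text \<open>A sentence and its negation differ in truth value, hence as formulas, hence in code. So
  some entry of a violation is positive, which makes the logarithm of its size meaningful.\<close>

lemma violation_neq: "violation x y p q \<Longrightarrow> x \<noteq> y"
  unfolding violation_def
  by (metis gn_inj Pi_sent_sentence prenex_neg_sentence sentence_formula sat_prenex_neg)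

text \<open>For a violation of least size \<open>m\<close>, \<open>\<sharp>{S}\<close> is \<open>\<lfloor>Log m\<rfloor>\<close>, so both proofs are short enough for
  stability to apply; it makes a sentence \<open>\<Psi>\<close> and its negation good at bounds that contradict
  each other.\<close>

lemma selfcons_true:
  assumes "EA_stable \<xi>"
  shows "true_std L S"
proof (rule ccontr)
  assume "\<not> true_std L S"
  then obtain x0 y0 p0 q0 where v0: "violation x0 y0 p0 q0"
    by (auto simp: true_std_def sat_std_selfcons)
  \<comment> \<open>The size of a violation is its largest entry, since goodness at \<open>j\<close>
    excludes exactly the violations with all four entries below \<open>2 powr j\<close>.\<close>
  define P where "P m \<longleftrightarrow> (\<exists>x y p q. violation x y p q \<and> m = Max {x, y, p, q})" for m
  define m where "m = (LEAST m. P m)"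
  have "P m"
    unfolding m_def by (rule LeastI_ex) (use v0 in \<open>auto simp: P_def\<close>)
  then obtain x y p q where v: "violation x y p q" and m: "m = Max {x, y, p, q}"
    by (auto simp: P_def)
  have min: "m \<le> Max {x', y', p', q'}" if "violation x' y' p' q'" for x' y' p' q'
    unfolding m_def by (rule Least_le) (use that in \<open>auto simp: P_def\<close>)
  have le: "x \<le> m" "y \<le> m" "p \<le> m" "q \<le> m" by (auto simp: m)
  then have m1: "m \<ge> 1" using violation_neq[OF v] by linarith
  define J where "J = \<lfloor>log 2 (real m)\<rfloor>"
  have J: "2 powr J \<le> m" "m < 2 powr (J + 1)"
    using m1 floor_log_eq_powr_iff[of "real m" 2 J] by (auto simp: J_def)
  have "J \<ge> 0" using m1 by (simp add: J_def)
  \<comment> \<open>From \<open>J + 1\<close> on, the least violation lies within range; up to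
    \<open>J\<close> the bound is at most \<open>m\<close>, so minimality excludes every
    violation.\<close>
  have good_iff: "good \<xi> S (ereal (real_of_int j)) \<longleftrightarrow> j \<le> J" for j
  proof
    assume g: "good \<xi> S (ereal (real_of_int j))"
    show "j \<le> J"
    proof (rule ccontr)
      assume "\<not> j \<le> J"
      then have "2 powr (J + 1) \<le> (2::real) powr j" by (intro powr_mono) auto
      with J have "real m < 2 powr j" by linarith
      then have "real x < 2 powr j" "real y < 2 powr j" "real p < 2 powr j" "real q < 2 powr j"
        using le by linarith+
      with g v show False by (auto simp: good_selfcons)
    qed
  next
    assume "j \<le> J"
    then have "(2::real) powr j \<le> 2 powr J" by (intro powr_mono) auto
    with J have *: "2 powr j \<le> real m" by linarith
    show "good \<xi> S (ereal (real_of_int j))"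
      unfolding good_selfcons
    proof (intro allI impI notI)
      fix x' y' p' q'
      assume "real x' < 2 powr j" "real y' < 2 powr j" "real p' < 2 powr j" "real q' < 2 powr j"
      moreover assume "violation x' y' p' q'"
      ultimately show False using min[of x' y' p' q'] * by simp
    qed
  qed
  have sharp: "sharp \<xi> {S} = ereal J"
    unfolding sharp_def by (rule Sup_eqI) (auto simp: good_iff)
  from v obtain \<Psi> where \<Psi>: "\<Psi> \<in> Pi_sent \<xi> 1" "proof_of \<xi> ({S} \<union> base \<xi>) \<Psi> p"
      "proof_of \<xi> ({S} \<union> base \<xi>) (prenex_neg \<Psi>) q"
    by (auto simp: violation_def Un_commute)
  have RE: "{S} \<in> RE_Class \<xi>"
    using selfcons_Pi rec_enumerable_singleton by (simp add: RE_Class_def)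
  \<comment> \<open>The \<open>+ 1\<close> in the stability conditions makes up for the floor in
    \<open>J\<close>: both codes are at most \<open>m\<close>, but \<open>log 2 m\<close> may exceed
    \<open>J\<close>.\<close>
  have short: "ereal (log 2 (real p)) \<le> sharp \<xi> {S} + 1"
      "ereal (log 2 (real q)) \<le> sharp \<xi> {S} + 1"
    using log_le_floor_log(1)[OF le(3) m1] log_le_floor_log(1)[OF le(4) m1]
    by (simp_all add: sharp J_def one_ereal_def)
  have "good \<xi> \<Psi> (sharp \<xi> {S} / 2)"
    using assms RE \<Psi>(1,2) short(1) unfolding EA_stable_def A_stable_def by blast
  moreover have "sharp \<xi> {S} / 2 = ereal (J / 2)"
    by (simp add: sharp)
  ultimately have 1: "true_std L (scope (E_term \<xi> (J / 2)) \<Psi>)"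
    by (simp add: good_def)
  have "good \<xi> (prenex_neg \<Psi>) (ereal (real_of_int \<lfloor>log 2 (real q)\<rfloor> / 2 - 1))"
    using assms RE \<Psi>(3) prenex_neg_Sigma[OF \<Psi>(1)] short(2)
    unfolding EA_stable_def E_stable_def by blast
  then have 2: "true_std L
      (scope (E_term \<xi> (real_of_int \<lfloor>log 2 (real q)\<rfloor> / 2 - 1)) (prenex_neg \<Psi>))"
    by (simp add: good_def)
  \<comment> \<open>The bound from E-stability for the negation must not exceed the bound from
    A-stability for \<open>\<Psi>\<close>; this holds because \<open>q \<le> m\<close>.\<close>
  have "real_of_int \<lfloor>log 2 (real q)\<rfloor> / 2 - 1 \<le> J / 2"
    using log_le_floor_log(2)[OF le(4) m1] by (simp add: J_def)
  then have "nat \<lceil>2 powr (real_of_int \<lfloor>log 2 (real q)\<rfloor> / 2 - 1)\<rceil> \<le> nat \<lceil>2 powr (J / 2)\<rceil>"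
    by (intro nat_mono ceiling_mono powr_mono) auto
  moreover obtain k \<phi> where "\<Psi> = (Forall ^^ k) \<phi>" "fully_bounded \<phi>"
    using Pi_sentE[OF \<Psi>(1)] Delta0_bounded by metis
  ultimately show False
    using sat_scope_prenex_neg[OF val_E_term val_E_term] 1 2
    unfolding true_std_def by blast
qed


section \<open>The translation\<close>

text \<open>\<open>refl_fm\<close> says that no proof from \<open>\<alpha>\<close> proves the negation of the sentence with code \<open>Var 0\<close>.
  Referring to that negation through \<open>\<nu>\<close> makes the translation a mere substitution, which is
  recursive on codes by assumption.\<close>

definition refl_fm :: "('f, 'r) fm" where
  "refl_fm = Forall (Forall (Neg (Conj (inst \<nu> [Var 2, Var 1])
     (inst \<sigma> [numl \<xi> (gn \<xi> \<Gamma>), Var 1, Var 0]))))"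

definition transl :: "('f, 'r) fm \<Rightarrow> ('f, 'r) fm" where
  "transl \<Psi> = subst (\<lambda>_. numl \<xi> (gn \<xi> \<Psi>)) refl_fm"

section \<open>Form and meaning of the translation\<close>

lemma wf_refl_fm: "wf_fm L 1 refl_fm"
  by (auto simp: refl_fm_def intro!: wf_inst_nu wf_inst_sg)

lemma sat_transl:
  "sat M e (transl \<Psi>) \<longleftrightarrow> (\<forall>y\<in>dom M. \<forall>q\<in>dom M.
     \<not> (sat M ((!) [closed_val M (gn \<xi> \<Psi>), y]) \<nu> \<and>
        sat M ((!) [closed_val M (gn \<xi> \<Gamma>), y, q]) \<sigma>))"
  unfolding transl_def sat_subst by (simp add: refl_fm_def)

text \<open>\<open>n\<close> is arbitrary because the translation occurs both as a sentence and
  below the quantifier over \<open>p\<close>.\<close>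

lemma wf_transl: "wf_fm L n (transl \<Psi>)"
  unfolding transl_def using wf_fm_subst[OF wf_refl_fm] by simp

lemma transl_Pi: "transl \<Psi> \<in> Pi_sent \<xi> 1"
proof -
  let ?m = "Neg (Conj (inst \<nu> [Var 2, Var 1]) (inst \<sigma> [numl \<xi> (gn \<xi> \<Gamma>), Var 1, Var 0]))"
  let ?m' = "subst (lift_subst (lift_subst (\<lambda>_. numl \<xi> (gn \<xi> \<Psi>)))) ?m"
  have eq: "transl \<Psi> = (Forall ^^ 2) ?m'"
    by (simp add: transl_def refl_fm_def numeral_2_eq_2)
  have "?m \<in> Delta0 \<xi>"
    by (intro Delta0_Neg Delta0_Conj Delta0_inst Delta0_nu Delta0_sg)
      (auto intro: ex_wf_Var ex_wf_numl)
  then have "?m' \<in> Delta0 \<xi>"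
    by (rule Delta0_subst) (intro ex_wf_lift_subst ex_wf_numl)
  moreover have "transl \<Psi> \<in> sentences L"
    using wf_transl by (simp add: sentences_def)
  ultimately show ?thesis
    using eq Pi_sentI[of 2] by metis
qed

text \<open>In the standard model \<open>\<nu>\<close> pins \<open>y\<close> down to the code of the
  negation, as \<open>gn\<close> is injective; what remains says that no \<open>q\<close> codes a
  proof of it from \<open>\<alpha>\<close>.\<close>

lemma true_transl:
  assumes "\<Psi> \<in> Pi_sent \<xi> 1"
  shows "true_std L (transl \<Psi>) \<longleftrightarrow> \<not> proves \<xi> \<alpha> (prenex_neg \<Psi>)"
proof -
  have "sat N ((!) [gn \<xi> \<Psi>, y]) \<nu> \<longleftrightarrow> y = gn \<xi> (prenex_neg \<Psi>)" for y
    using assms gn_inj Pi_sent_sentence sentence_formula unfolding nu_std by metis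
  then have "true_std L (transl \<Psi>) \<longleftrightarrow>
      (\<forall>q. \<not> sat N ((!) [gn \<xi> \<Gamma>, gn \<xi> (prenex_neg \<Psi>), q]) \<sigma>)"
    by (simp add: true_std_def sat_transl)
  then show ?thesis
    using assms by (simp add: sg_std Pi_sent_sentence prenex_neg_sentence proves_def)
qed

lemma alpha_sentences: "\<alpha> \<subseteq> sentences L"
  using base_true selfcons_sentence by blast

lemma true_transl_iff:
  assumes "EA_stable \<xi>" "\<Psi> \<in> Pi_sent \<xi> 1"
  shows "true_std L (transl \<Psi>) \<longleftrightarrow> true_std L \<Psi>"
proof
  assume "true_std L \<Psi>"
  have "\<not> proves \<xi> \<alpha> (prenex_neg \<Psi>)"
  proof
    assume "proves \<xi> \<alpha> (prenex_neg \<Psi>)"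
    then have "entails L \<alpha> (prenex_neg \<Psi>)"
      by (intro ded_sound alpha_sentences prenex_neg_sentence Pi_sent_sentence assms(2))
    moreover have "\<forall>\<phi>\<in>\<alpha>. sat N e \<phi>" for e
      using selfcons_true[OF assms(1)] base_true by (auto simp: true_std_def)
    \<comment> \<open>The standard model is among the structures on natural numbers that
      \<open>entails\<close> considers; any environment will do.\<close>
    ultimately have "sat N (\<lambda>_. 0) (prenex_neg \<Psi>)"
      using structure_for_standard_model[of L] unfolding entails_def by fastforce
    with \<open>true_std L \<Psi>\<close> show False by (simp add: sat_prenex_neg true_std_def)
  qed
  then show "true_std L (transl \<Psi>)" using assms(2) by (simp add: true_transl)
next
  assume "true_std L (transl \<Psi>)"
  then have np: "\<not> proves \<xi> \<alpha> (prenex_neg \<Psi>)" using assms(2) by (simp add: true_transl)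
  show "true_std L \<Psi>"
  proof (rule ccontr)
    assume "\<not> true_std L \<Psi>"
    then obtain e where "sat N e (prenex_neg \<Psi>)"
      by (auto simp: true_std_def sat_prenex_neg)
    \<comment> \<open>So far the negation holds in one environment; for a sentence one environment
      decides truth.\<close>
    then have "true_std L (prenex_neg \<Psi>)"
      by (rule true_std_sentence[OF prenex_neg_sentence[OF Pi_sent_sentence[OF assms(2)]],
            THEN iffD2])
    then have "proves \<xi> (base \<xi>) (prenex_neg \<Psi>)"
      by (rule Sigma_complete[OF prenex_neg_Sigma[OF assms(2)]])
    then have "proves \<xi> \<alpha> (prenex_neg \<Psi>)"
      by (rule ded_mono[OF Un_upper1 alpha_sentences
            prenex_neg_sentence[OF Pi_sent_sentence[OF assms(2)]]])
    with np show False ..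
  qed
qed

text \<open>\<open>refl_fm\<close> is one fixed formula, so only the numeral varies, and the
  constant substitution in \<open>transl\<close> has the shape that \<open>goedel_encoding\<close>
  makes recursive.\<close>

lemma transl_recursive:
  "\<exists>f. recursive 1 f \<and> (\<forall>\<Psi>\<in>Pi_sent \<xi> 1. f [gn \<xi> \<Psi>] = gn \<xi> (transl \<Psi>))"
proof -
  obtain f where f: "recursive 2 f"
    "\<And>\<phi> k. \<phi> \<in> formulas L \<Longrightarrow> f [gn \<xi> \<phi>, k] = gn \<xi> (subst (\<lambda>_. numl \<xi> k) \<phi>)"
    using gc_encoding unfolding goedel_encoding_def by metis
  have "refl_fm \<in> formulas L" using wf_refl_fm by (auto simp: formulas_def)
  then show ?thesis
    using f(2) recursive_fix_first[OF f(1), of "gn \<xi> refl_fm"]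
    by (intro exI[of _ "\<lambda>xs. f [gn \<xi> refl_fm, xs ! 0]"]) (simp add: transl_def)
qed

text \<open>Instantiating \<open>x\<close> in \<open>S\<close> at the numeral for
  \<open>\<Psi>\<close> gives the claim, so it follows logically from \<open>S\<close>. The
  completeness clause covers only valid sentences, hence the detour through an implication from
  \<open>S\<close>.\<close>

lemma proves_reflection:
  "proves \<xi> \<alpha> (Forall (Imp (Prf_alpha \<xi> \<nu> \<sigma> (numl \<xi> (gn \<xi> \<Psi>)) (Var 0)) (transl \<Psi>)))"
    (is "proves \<xi> \<alpha> ?Z")
proof -
  have S: "proves \<xi> \<alpha> S"
    by (intro ded_axiom alpha_sentences) simp
  have Z: "?Z \<in> sentences L"
    by (auto simp: sentences_def Prf_alpha_def wf_transl intro!: wf_inst_sg)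
  have sat: "sat M e ?Z" if M: "structure_for L M" and S: "sat M e S"
    for M :: "(nat, 'f, 'r) struct" and e
  proof -
    have "closed_val M (gn \<xi> \<Psi>) \<in> dom M"
      unfolding closed_val_def by (rule val_closed_in_dom[OF M wf_numl])
    then have "\<not> (sat M ((!) [closed_val M (gn \<xi> \<Psi>), y]) \<nu> \<and>
          sat M ((!) [closed_val M (gn \<xi> \<Gamma>), closed_val M (gn \<xi> \<Psi>), p]) \<sigma> \<and>
          sat M ((!) [closed_val M (gn \<xi> \<Gamma>), y, q]) \<sigma>)"
      if "p \<in> dom M" "y \<in> dom M" "q \<in> dom M" for p y q
      using S that unfolding sat_selfcons by blast
    moreover have "sat M e ?Z \<longleftrightarrow> (\<forall>p\<in>dom M.
        sat M ((!) [closed_val M (gn \<xi> \<Gamma>), closed_val M (gn \<xi> \<Psi>), p]) \<sigma> \<longrightarrow>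
        (\<forall>y\<in>dom M. \<forall>q\<in>dom M. \<not> (sat M ((!) [closed_val M (gn \<xi> \<Psi>), y]) \<nu> \<and>
          sat M ((!) [closed_val M (gn \<xi> \<Gamma>), y, q]) \<sigma>)))"
      unfolding Prf_alpha_def sat.simps(7,8) sat_transl sat_sg by simp
    ultimately show ?thesis by blast
  qed
  \<comment> \<open>Indirect implication takes two premises, so \<open>S\<close> stands for
    both.\<close>
  then have "entails L {} (Imp (Conj S S) ?Z)"
    unfolding entails_def sat.simps(5,7) by blast
  moreover have "Imp (Conj S S) ?Z \<in> sentences L"
    using Z selfcons_sentence by (simp add: sentences_def)
  ultimately have "proves \<xi> \<alpha> (Imp (Conj S S) ?Z)"
    by (intro ded_valid alpha_sentences)
  then show ?thesis
    using Z selfcons_sentence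
    by (elim ded_indirect_implication[OF alpha_sentences _ S S, rotated]) auto
qed

end

theorem theorem6p12:
  fixes \<xi> :: "('f, 'r, 'p) configuration" and \<nu> \<sigma> :: "('f, 'r) fm"
  assumes "generic_configuration \<xi>"
    and "EA_stable \<xi>"
    and "is_Neg \<xi> 1 \<nu>"
    and "is_SubstPrf \<xi> (base \<xi>) \<sigma>"
  shows "\<exists>T. translation \<xi> T \<and>
    (\<forall>\<Psi>\<in>Pi_sent \<xi> 1.
       proves \<xi> (base \<xi> \<union> {selfcons \<xi> \<nu> \<sigma>})
         (Forall (Imp (Prf_alpha \<xi> \<nu> \<sigma> (numl \<xi> (gn \<xi> \<Psi>)) (Var 0)) (T \<Psi>))))"
proof -
  interpret self_justifying \<xi> \<nu> \<sigma>
    using assms by unfold_locales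
  have "translation \<xi> transl"
    unfolding translation_def
    using transl_Pi true_transl_iff[OF assms(2)] transl_recursive by blast
  then show ?thesis using proves_reflection by blast
qed

end
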